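(* Let $(M,\Delta)$ be a Garside monoid. Then, for every $\mathrm{Div}(\Delta)$-word $w$ of length $p$, there exists a unique $\Delta$-normal word $N^{\Delta}(w)$ of length $p$ that represents the same element of $M$ as $w$. Moreover, for $p \ge 2$, one has $$N^{\Delta}(w) = \overline{N^{\Delta}}_{\delta_p}(w),$$ where the finite sequence of positions $\delta_p$ is inductively defined by $\delta_2 := 1$ and $\delta_p := \mathrm{sh}(\delta_{p-1}) \mid 1 \mid 2 \mid \cdots \mid p-1$, with $\mathrm{sh}$ the shift of all entries by $+1$ (so $\delta_3 = 2|1|2$, $\delta_4 = 3|2|3|1|2|3$, etc.).
   Context: Divisibility: in a monoid $M$, $f \preccurlyeq g$ ($f$ is a left-divisor of $g$, $g$ is a right-multiple of $f$) means $\exists g'\in M\ (fg'=g)$; $f$ is a right-divisor of $g$ (and $g$ a left-multiple of $f$) if $\exists g'\in M\ (g'f=g)$. $f \prec g$ means $f\preccurlyeq g$ and $g\not\preccurlyeq f$. A Garside monoid is a pair $(M,\Delta)$ where $M$ is a cancellative monoid such that: (i) there is $\lambda: M\to\mathbb{N}$ with $\lambda(fg)\ge\lambda(f)+\lambda(g)$ for all $f,g$, and $g\neq 1 \Rightarrow \lambda(g)\neq 0$; (ii) any two elements of $M$ admit left- and right-lcms and gcds (greatest common left-divisor and least common right-multiple for left-divisibility, and symmetrically for right-divisibility); (iii) $\Delta\in M$ is such that the left- and right-divisors of $\Delta$ coincide and generate $M$; (iv) the set $\mathrm{Div}(\Delta)$ of all divisors of $\Delta$ is finite. A $\mathrm{Div}(\Delta)$-word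 $s_1|\cdots|s_p$ (finite sequence of elements of $\mathrm{Div}(\Delta)$) represents the element $s_1\cdots s_p$ of $M$. It is called $\Delta$-normal if, for every $i<p$, $\forall s\in \mathrm{Div}(\Delta)\ (s_i \prec s \Rightarrow s \not\preccurlyeq s_i s_{i+1}\cdots s_p)$. (Entries equal to $1$ are allowed.) Notation: for a set $S$, $S^{[2]}$ is the set of $S$-words of length two. $\overline{N^{\Delta}}$ is the restriction of $N^\Delta$ to words of length two. For a map $F: S^{[2]}\to S^{[2]}$ and $i\ge1$, $F_i$ is the partial map on $S^*$ that applies $F$ to the entries in positions $i$ and $i+1$; for a finite sequence $u=i_1|\cdots|i_n$ of positive integers, $F_u := F_{i_n}\circ\cdots\circ F_{i_1}$ ($F_{i_1}$ is applied first). *)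

theory Defs
  imports "HOL-Algebra.Divisibility"
begin

text \<open>
  The relation \<open>a divides\<^bsub>M\<^esub> b\<close> of HOL-Algebra is left-divisibility, i.e. \<open>b = a c\<close> for
  some \<open>c\<close> in the carrier, and \<open>properfactor\<close> is its strict part.
  Accordingly \<open>gcdof\<^bsub>M\<^esub>\<close> and \<open>lcmof\<^bsub>M\<^esub>\<close> are the left-gcd (greatest common left-divisor)
  and the right-lcm (least common right-multiple).  The symmetric notions (right-divisor,
  right-gcd, left-lcm) are the same notions in the opposite monoid.
\<close>

definition opposite :: "('a, 'b) monoid_scheme \<Rightarrow> ('a, 'b) monoid_scheme"
  where "opposite M = M\<lparr>mult := \<lambda>x y. y \<otimes>\<^bsub>M\<^esub> x\<rparr>"

lemma carrier_opposite [simp]: "carrier (opposite M) = carrier M"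
  and mult_opposite [simp]: "x \<otimes>\<^bsub>opposite M\<^esub> y = y \<otimes>\<^bsub>M\<^esub> x"
  and one_opposite [simp]: "\<one>\<^bsub>opposite M\<^esub> = \<one>\<^bsub>M\<^esub>"
  by (simp_all add: opposite_def)

lemma divides_opposite_iff:
  "a divides\<^bsub>opposite M\<^esub> b \<longleftrightarrow> (\<exists>c\<in>carrier M. b = c \<otimes>\<^bsub>M\<^esub> a)"
  by (simp add: factor_def)

definition Divs :: "('a, 'b) monoid_scheme \<Rightarrow> 'a \<Rightarrow> 'a set"
  where "Divs M d = {s \<in> carrier M. s divides\<^bsub>M\<^esub> d}"

locale garside_monoid = monoid_cancel M for M :: "('a, 'b) monoid_scheme" (structure) +
  fixes \<Delta> :: 'a
  assumes length_function:
      "\<exists>l :: 'a \<Rightarrow> nat.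
         (\<forall>f\<in>carrier M. \<forall>g\<in>carrier M. l (f \<otimes> g) \<ge> l f + l g) \<and>
         (\<forall>g\<in>carrier M. g \<noteq> \<one> \<longrightarrow> l g \<noteq> 0)"
    and left_gcd_exists:
      "\<lbrakk>f \<in> carrier M; g \<in> carrier M\<rbrakk> \<Longrightarrow> \<exists>h\<in>carrier M. h gcdof\<^bsub>M\<^esub> f g"
    and right_lcm_exists:
      "\<lbrakk>f \<in> carrier M; g \<in> carrier M\<rbrakk> \<Longrightarrow> \<exists>h\<in>carrier M. h lcmof\<^bsub>M\<^esub> f g"
    and right_gcd_exists:
      "\<lbrakk>f \<in> carrier M; g \<in> carrier M\<rbrakk> \<Longrightarrow> \<exists>h\<in>carrier M. h gcdof\<^bsub>opposite M\<^esub> f g"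
    and left_lcm_exists:
      "\<lbrakk>f \<in> carrier M; g \<in> carrier M\<rbrakk> \<Longrightarrow> \<exists>h\<in>carrier M. h lcmof\<^bsub>opposite M\<^esub> f g"
    and Delta_closed: "\<Delta> \<in> carrier M"
    and left_right_divisors_coincide: "Divs M \<Delta> = Divs (opposite M) \<Delta>"
    and divisors_generate: "\<Inter> {H. submonoid H M \<and> Divs M \<Delta> \<subseteq> H} = carrier M"
    and finite_divisors: "finite (Divs M \<Delta>)"

definition words :: "'a set \<Rightarrow> nat \<Rightarrow> 'a list set"
  where "words S p = {w \<in> lists S. length w = p}"

definition word_value :: "('a, 'b) monoid_scheme \<Rightarrow> 'a list \<Rightarrow> 'a"
  where "word_value M w = foldr (\<otimes>\<^bsub>M\<^esub>) w \<one>\<^bsub>M\<^esub>"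

text \<open>Lists are indexed from \<open>0\<close>, so \<open>drop i w\<close> is the suffix beginning with \<open>w ! i\<close>.\<close>

definition Delta_normal :: "('a, 'b) monoid_scheme \<Rightarrow> 'a \<Rightarrow> 'a list \<Rightarrow> bool"
  where "Delta_normal M \<Delta> w \<longleftrightarrow>
    (\<forall>i. Suc i < length w \<longrightarrow>
      (\<forall>s\<in>Divs M \<Delta>. properfactor M (w ! i) s \<longrightarrow>
         \<not> s divides\<^bsub>M\<^esub> word_value M (drop i w)))"

definition is_normal_form :: "('a, 'b) monoid_scheme \<Rightarrow> 'a \<Rightarrow> 'a list \<Rightarrow> 'a list \<Rightarrow> bool"
  where "is_normal_form M \<Delta> w v \<longleftrightarrow>
    v \<in> words (Divs M \<Delta>) (length w) \<and> Delta_normal M \<Delta> v \<and>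
    word_value M v = word_value M w"

definition normal_form :: "('a, 'b) monoid_scheme \<Rightarrow> 'a \<Rightarrow> 'a list \<Rightarrow> 'a list"
  where "normal_form M \<Delta> w = (THE v. is_normal_form M \<Delta> w v)"

definition normal_form2 :: "('a, 'b) monoid_scheme \<Rightarrow> 'a \<Rightarrow> 'a list \<rightharpoonup> 'a list"
  where "normal_form2 M \<Delta> = (Some \<circ> normal_form M \<Delta>) |` words (Divs M \<Delta>) 2"

text \<open>
  The partial maps \<open>F\<^sub>i\<close> and \<open>F\<^sub>u\<close> on \<open>S\<close>-words, for \<open>F\<close> a map on the \<open>S\<close>-words of length two.
  Positions are counted from \<open>1\<close>: the entries in positions \<open>i\<close> and \<open>i + 1\<close> are
  \<open>w ! (i - 1)\<close> and \<open>w ! i\<close>.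
\<close>

definition apply_at :: "'a set \<Rightarrow> ('a list \<rightharpoonup> 'a list) \<Rightarrow> nat \<Rightarrow> 'a list \<rightharpoonup> 'a list"
  where "apply_at S F i w =
    (if w \<in> lists S \<and> 1 \<le> i \<and> i < length w
     then map_option (\<lambda>v. take (i - 1) w @ v @ drop (i + 1) w) (F [w ! (i - 1), w ! i])
     else None)"

primrec apply_seq :: "'a set \<Rightarrow> ('a list \<rightharpoonup> 'a list) \<Rightarrow> nat list \<Rightarrow> 'a list \<rightharpoonup> 'a list"
  where
    "apply_seq S F [] w = (if w \<in> lists S then Some w else None)"
  | "apply_seq S F (i # u) w = Option.bind (apply_at S F i w) (apply_seq S F u)"

text \<open>Only the values for \<open>p \<ge> 2\<close> are meaningful.\<close>

fun delta :: "nat \<Rightarrow> nat list"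
  where
    "delta 0 = []"
  | "delta (Suc 0) = []"
  | "delta (Suc (Suc 0)) = [1]"
  | "delta (Suc (Suc (Suc n))) = map Suc (delta (Suc (Suc n))) @ [1..<Suc (Suc (Suc n))]"

lemma delta_2: "delta 2 = [1]"
  by (simp add: numeral_2_eq_2)

lemma delta_rec: "p \<ge> 3 \<Longrightarrow> delta p = map Suc (delta (p - 1)) @ [1..<p]"
  by (cases p rule: delta.cases) auto

lemma "delta 3 = [2, 1, 2]" "delta 4 = [3, 2, 3, 1, 2, 3]"
  by (simp_all add: delta_rec delta_2 upt_rec)

end

(*
  A word over Div(Delta) is Delta-normal iff each entry is the greatest divisor of Delta
  that left-divides the value of the suffix starting there; uniqueness is then cancellation.
  For s, r in Div(Delta), the right-lcm of s and r is s t with t again in Div(Delta), so a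
  divisor r of Delta left-divides s g iff it left-divides s t for some divisor t of Delta
  that left-divides g.  Hence, if t_1|...|t_q is normal, s t_1...t_q and s t_1 have the same
  divisors in Div(Delta): normalizing the first two entries of s|t_1|...|t_q produces the
  correct first entry, and iterating to the right normalizes the whole word.
*)
theory Submission
  imports Defs
begin

section \<open>Word values and sequences of positions\<close>

lemma word_value_simps [simp]:
  "word_value M [] = \<one>\<^bsub>M\<^esub>"
  "word_value M (x # w) = x \<otimes>\<^bsub>M\<^esub> word_value M w"
  by (simp_all add: word_value_def)

text \<open>The bound excludes \<open>i = 0\<close>: position 0 is undefined on \<open>w\<close>,
  while its shift 1 may be defined on \<open>x # w\<close>.\<close>

lemma apply_at_Suc_Cons:
  assumes "x \<in> S" "1 \<le> i"
  shows "apply_at S F (Suc i) (x # w) = map_option (Cons x) (apply_at S F i w)"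
  using assms by (cases i) (auto simp: apply_at_def option.map_comp o_def)

lemma apply_seq_map_Suc:
  assumes "x \<in> S" "\<forall>i\<in>set u. 1 \<le> i"
  shows "apply_seq S F (map Suc u) (x # w) = map_option (Cons x) (apply_seq S F u w)"
  using assms(2)
proof (induction u arbitrary: w)
  case (Cons i u)
  then show ?case
    by (cases "apply_at S F i w") (simp_all add: apply_at_Suc_Cons assms(1))
qed (simp add: assms(1))

lemma apply_seq_append:
  "apply_seq S F (u @ v) w = Option.bind (apply_seq S F u w) (apply_seq S F v)"
proof (induction u arbitrary: w)
  case Nil
  \<comment> \<open>Outside \<open>lists S\<close> the left side must be \<open>None\<close> too;
    for nonempty \<open>v\<close> this comes from the membership test in
    \<open>apply_at\<close>.\<close>
  show ?case by (cases v) (auto simp: apply_at_def)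
next
  case (Cons i u)
  then show ?case by (cases "apply_at S F i w") simp_all
qed

text \<open>The empty values at 0 and 1 extend the recursion down to \<open>p = 0\<close>, so
  inductions can start at the empty word.\<close>

lemma delta_Suc: "delta (Suc p) = map Suc (delta p) @ [1..<Suc p]"
  by (cases p rule: delta.cases) simp_all

lemma delta_pos: "i \<in> set (delta p) \<Longrightarrow> 1 \<le> i"
  by (induction p) (auto simp: delta_Suc simp del: delta.simps(3,4))

lemma all_nat_split: "(\<forall>i. P i) \<longleftrightarrow> P 0 \<and> (\<forall>i. P (Suc i))"
  by (metis not0_implies_Suc)

section \<open>Divisibility and the divisors of \<open>\<Delta>\<close>\<close>

context garside_monoid
begin

abbreviation S :: "'a set"
  where "S \<equiv> Divs M \<Delta>"

lemma Divs_closed: "s \<in> S \<Longrightarrow> s \<in> carrier M"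
  by (simp add: Divs_def)

lemma word_value_closed [simp]: "w \<in> lists S \<Longrightarrow> word_value M w \<in> carrier M"
  by (induction w) (auto simp: Divs_closed)

lemma divides_mult_self [simp]:
  "x \<in> carrier M \<Longrightarrow> y \<in> carrier M \<Longrightarrow> x divides x \<otimes> y"
  by (auto simp: factor_def)

text \<open>Superadditivity forces the length function to vanish at \<open>\<one>\<close>, hence on
  both factors of \<open>\<one>\<close>.\<close>

lemma mult_eq_one_imp:
  assumes "x \<in> carrier M" "y \<in> carrier M" "x \<otimes> y = \<one>"
  shows "x = \<one>"
proof -
  obtain l :: "'a \<Rightarrow> nat"
    where super: "\<forall>f\<in>carrier M. \<forall>g\<in>carrier M. l f + l g \<le> l (f \<otimes> g)"
      and nonzero: "\<forall>g\<in>carrier M. g \<noteq> \<one> \<longrightarrow> l g \<noteq> 0"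
    using length_function by blast
  from super have "l \<one> + l \<one> \<le> l (\<one> \<otimes> \<one>)" by blast
  then have "l \<one> = 0" by simp
  moreover from super assms have "l x + l y \<le> l \<one>" by metis
  ultimately show ?thesis using nonzero assms(1) by auto
qed

text \<open>By cancellation the two quotients multiply to \<open>\<one>\<close>, so both are
  trivial.\<close>

lemma divides_antisym:
  assumes "a \<in> carrier M" "b \<in> carrier M" "a divides b" "b divides a"
  shows "a = b"
proof -
  obtain x where x: "x \<in> carrier M" "b = a \<otimes> x"
    using assms(3) by (auto simp: factor_def)
  obtain y where y: "y \<in> carrier M" "a = b \<otimes> y"
    using assms(4) by (auto simp: factor_def)
  have "a \<otimes> (x \<otimes> y) = b \<otimes> y"
    using x y(1) assms(1) by (simp add: m_assoc)
  then have "a \<otimes> (x \<otimes> y) = a \<otimes> \<one>"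
    using y(2) [symmetric] assms(1) by simp
  then have "x \<otimes> y = \<one>"
    using x(1) y(1) assms(1) by (simp only: l_cancel m_closed one_closed)
  then have "x = \<one>"
    using mult_eq_one_imp x(1) y(1) by blast
  then show ?thesis
    using x(2) assms(1) by simp
qed

text \<open>A right factor of a right-divisor of \<open>\<Delta>\<close> is again one, and left- and
  right-divisors of \<open>\<Delta>\<close> coincide.\<close>

lemma Divs_right_factor:
  assumes "x \<in> carrier M" "y \<in> carrier M" "x \<otimes> y \<in> S"
  shows "y \<in> S"
proof -
  have "x \<otimes> y \<in> Divs (opposite M) \<Delta>"
    using assms left_right_divisors_coincide by simp
  then obtain c where "c \<in> carrier M" "\<Delta> = c \<otimes> (x \<otimes> y)"
    by (auto simp: Divs_def divides_opposite_iff)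
  then have "c \<otimes> x \<in> carrier M" "\<Delta> = (c \<otimes> x) \<otimes> y"
    using assms by (simp_all add: m_assoc)
  then have "y \<in> Divs (opposite M) \<Delta>"
    using assms by (auto simp: Divs_def divides_opposite_iff)
  then show ?thesis using left_right_divisors_coincide by simp
qed

text \<open>\<open>\<Delta>\<close> is a common right-multiple of \<open>s\<close> and
  \<open>r\<close>, so their lcm divides it; \<open>t\<close> is a right factor of that lcm.\<close>

lemma right_complement_in_Divs:
  assumes "s \<in> S" "r \<in> S"
  obtains t where "t \<in> S" "(s \<otimes> t) lcmof\<^bsub>M\<^esub> s r"
proof -
  have s: "s \<in> carrier M" "s divides \<Delta>" and r: "r \<in> carrier M" "r divides \<Delta>"
    using assms by (auto simp: Divs_def)
  obtain m where m: "m \<in> carrier M" "m lcmof\<^bsub>M\<^esub> s r"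
    using right_lcm_exists s r by blast
  then have "m divides \<Delta>"
    using s r Delta_closed by (simp add: islcm_def)
  then have "m \<in> S" using m by (simp add: Divs_def)
  moreover obtain t where "t \<in> carrier M" "m = s \<otimes> t"
    using m by (auto simp: islcm_def factor_def)
  ultimately show ?thesis
    using that m s Divs_right_factor by blast
qed

lemma divides_mult_head:
  assumes "s \<in> S" "t \<in> S" "r \<in> S" "g \<in> carrier M"
    and head: "\<forall>q\<in>S. q divides g \<longrightarrow> q divides t"
    and "r divides s \<otimes> g"
  shows "r divides s \<otimes> t"
proof -
  note closed = assms(1-3) [THEN Divs_closed] assms(4)
  obtain q where q: "q \<in> S" "(s \<otimes> q) lcmof\<^bsub>M\<^esub> s r"
    using right_complement_in_Divs assms by blast
  have qc: "q \<in> carrier M" by (rule Divs_closed) fact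
  \<comment> \<open>Both \<open>s\<close> and \<open>r\<close> divide \<open>s \<otimes> g\<close>,
    hence so does their lcm; cancelling \<open>s\<close> lets \<open>head\<close> apply to
    \<open>q\<close>.\<close>
  have "s \<otimes> q divides s \<otimes> g"
    using q assms closed by (simp add: islcm_def)
  then have "q divides t"
    using head q closed qc by simp
  moreover have "r divides s \<otimes> q"
    using q by (simp add: islcm_def)
  ultimately show ?thesis
    using closed qc divides_trans [of r "s \<otimes> q" "s \<otimes> t"] by simp
qed

text \<open>Take for \<open>h\<close> the left-gcd of \<open>g\<close> and \<open>\<Delta>\<close>:
  their common left-divisors are the elements of \<open>S\<close> dividing \<open>g\<close>.\<close>

lemma left_gcd_Delta:
  assumes "g \<in> carrier M"
  obtains h where "h \<in> S" "h divides g" "\<forall>r\<in>S. r divides g \<longrightarrow> r divides h"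
  using left_gcd_exists [OF assms Delta_closed] by (auto simp: isgcd_def Divs_def)

section \<open>Normal words and their uniqueness\<close>

lemma Delta_normal_Nil [simp]: "Delta_normal M \<Delta> []"
  by (simp add: Delta_normal_def)

text \<open>Maximal and greatest agree here because any two elements of \<open>S\<close> dividing
  the value both divide its left-gcd with \<open>\<Delta>\<close>. For \<open>v = []\<close> both
  conditions on \<open>s\<close> are trivial.\<close>

lemma Delta_normal_Cons_iff:
  assumes "s \<in> S" "v \<in> lists S"
  shows "Delta_normal M \<Delta> (s # v) \<longleftrightarrow>
    (\<forall>r\<in>S. r divides s \<otimes> word_value M v \<longrightarrow> r divides s) \<and> Delta_normal M \<Delta> v"
proof -
  let ?g = "s \<otimes> word_value M v"
  have closed: "s \<in> carrier M" "word_value M v \<in> carrier M"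
    using assms Divs_closed by simp_all
  have "Delta_normal M \<Delta> (s # v) \<longleftrightarrow>
      (v \<noteq> [] \<longrightarrow> (\<forall>r\<in>S. properfactor M s r \<longrightarrow> \<not> r divides ?g)) \<and> Delta_normal M \<Delta> v"
    unfolding Delta_normal_def by (subst all_nat_split) simp
  also have "(v \<noteq> [] \<longrightarrow> (\<forall>r\<in>S. properfactor M s r \<longrightarrow> \<not> r divides ?g)) \<longleftrightarrow>
      (\<forall>r\<in>S. r divides ?g \<longrightarrow> r divides s)"
  proof
    assume L: "v \<noteq> [] \<longrightarrow> (\<forall>r\<in>S. properfactor M s r \<longrightarrow> \<not> r divides ?g)"
    show "\<forall>r\<in>S. r divides ?g \<longrightarrow> r divides s"
    proof (cases "v = []")
      case True
      then show ?thesis using closed by simp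
    next
      case False
      obtain h where h: "h \<in> S" "h divides ?g" "\<forall>r\<in>S. r divides ?g \<longrightarrow> r divides h"
        using left_gcd_Delta closed by blast
      have "s divides h" using h assms closed by simp
      \<comment> \<open>Otherwise \<open>s\<close> would be a proper divisor of \<open>h\<close>,
        and \<open>h\<close> would violate \<open>L\<close>.\<close>
      then have "h divides s"
        using L False h by (auto simp: properfactor_def)
      then show ?thesis
        using h closed by (meson Divs_closed divides_trans)
    qed
  qed (auto simp: properfactor_def)
  finally show ?thesis .
qed

text \<open>Each first letter is the greatest element of \<open>S\<close> dividing the common value,
  so they agree by antisymmetry; cancel them and recurse.\<close>

lemma Delta_normal_unique:
  assumes "v \<in> lists S" "v' \<in> lists S" "length v = length v'"
    and "Delta_normal M \<Delta> v" "Delta_normal M \<Delta> v'"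
    and "word_value M v = word_value M v'"
  shows "v = v'"
  using assms(3,1,2,4-)
proof (induction v v' rule: list_induct2)
  case (Cons x v y v')
  then have mem: "x \<in> S" "y \<in> S" "v \<in> lists S" "v' \<in> lists S"
    by simp_all
  then have closed: "x \<in> carrier M" "y \<in> carrier M"
    "word_value M v \<in> carrier M" "word_value M v' \<in> carrier M"
    by (simp_all add: Divs_closed)
  have eq: "x \<otimes> word_value M v = y \<otimes> word_value M v'"
    using Cons.prems by simp
  have nx: "\<forall>r\<in>S. r divides x \<otimes> word_value M v \<longrightarrow> r divides x" "Delta_normal M \<Delta> v"
    and ny: "\<forall>r\<in>S. r divides y \<otimes> word_value M v' \<longrightarrow> r divides y" "Delta_normal M \<Delta> v'"
    using Cons.prems mem by (simp_all add: Delta_normal_Cons_iff)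
  have "x divides x \<otimes> word_value M v" "y divides y \<otimes> word_value M v'"
    using closed by simp_all
  then have "x divides y" "y divides x"
    using nx ny mem eq by simp_all
  then have "x = y" using divides_antisym closed by blast
  then have "word_value M v = word_value M v'"
    using eq closed by (simp add: l_cancel)
  then show ?case using Cons.IH nx ny mem \<open>x = y\<close> by simp
qed simp

section \<open>Computing normal forms by two-letter steps\<close>

lemma normal_form_eqI:
  assumes "is_normal_form M \<Delta> w v"
  shows "normal_form M \<Delta> w = v"
  unfolding normal_form_def
proof (rule the_equality)
  fix v' assume "is_normal_form M \<Delta> w v'"
  then show "v' = v"
    using assms by (intro Delta_normal_unique) (auto simp: is_normal_form_def words_def)
qed fact

text \<open>The letter \<open>a\<close> is the left-gcd of \<open>s \<otimes> t\<close> and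
  \<open>\<Delta>\<close>. Two letters suffice: \<open>s\<close> divides \<open>a\<close>, so the
  remainder \<open>b\<close> is a right factor of \<open>t\<close> and stays in
  \<open>S\<close>.\<close>

lemma normal_form2_pair:
  assumes "s \<in> S" "t \<in> S"
  obtains a b where "normal_form2 M \<Delta> [s, t] = Some [a, b]" "a \<in> S" "b \<in> S"
    "a \<otimes> b = s \<otimes> t" "\<forall>r\<in>S. r divides s \<otimes> t \<longrightarrow> r divides a"
proof -
  have closed: "s \<in> carrier M" "t \<in> carrier M"
    using assms Divs_closed by simp_all
  obtain a where a: "a \<in> S" "a divides s \<otimes> t" "\<forall>r\<in>S. r divides s \<otimes> t \<longrightarrow> r divides a"
    using left_gcd_Delta closed by blast
  have ac: "a \<in> carrier M" by (rule Divs_closed) fact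
  obtain b where b: "b \<in> carrier M" "s \<otimes> t = a \<otimes> b"
    using a by (auto simp: factor_def)
  have "s divides a" using a assms closed by simp
  then obtain c where c: "c \<in> carrier M" "a = s \<otimes> c"
    by (auto simp: factor_def)
  have "t = c \<otimes> b"
    using b c closed by (simp add: m_assoc l_cancel)
  then have "b \<in> S"
    using Divs_right_factor assms b c by blast
  have "is_normal_form M \<Delta> [s, t] [a, b]"
    using a b \<open>b \<in> S\<close> closed
    by (simp add: is_normal_form_def words_def Delta_normal_Cons_iff)
  then have "normal_form2 M \<Delta> [s, t] = Some [a, b]"
    using assms by (simp add: normal_form2_def words_def normal_form_eqI)
  then show ?thesis using that a b \<open>b \<in> S\<close> by simp
qed

text \<open>One left-to-right pass: the first step turns \<open>s|t\<close> into \<open>a|b\<close>,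
  where \<open>a\<close> is already final, and \<open>b\<close> then plays the role of
  \<open>s\<close> before the shorter normal word.\<close>

lemma normalize_Cons:
  assumes "s \<in> S" "v \<in> lists S" "Delta_normal M \<Delta> v"
  shows "\<exists>u. apply_seq S (normal_form2 M \<Delta>) [1..<Suc (length v)] (s # v) = Some u
    \<and> is_normal_form M \<Delta> (s # v) u"
  using assms
proof (induction v arbitrary: s)
  case Nil
  then show ?case
    by (simp add: is_normal_form_def words_def Delta_normal_Cons_iff Divs_closed)
next
  case (Cons t v)
  then have mem: "t \<in> S" "v \<in> lists S" and nv: "Delta_normal M \<Delta> v"
    and nt: "\<forall>r\<in>S. r divides t \<otimes> word_value M v \<longrightarrow> r divides t"
    by (simp_all add: Delta_normal_Cons_iff)
  obtain a b where ab: "normal_form2 M \<Delta> [s, t] = Some [a, b]" "a \<in> S" "b \<in> S"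
    "a \<otimes> b = s \<otimes> t" "\<forall>r\<in>S. r divides s \<otimes> t \<longrightarrow> r divides a"
    using normal_form2_pair Cons.prems(1) mem(1) by blast
  note closed = Divs_closed [OF Cons.prems(1)] mem(1) [THEN Divs_closed]
    ab(2,3) [THEN Divs_closed] word_value_closed [OF mem(2)]
  obtain u where u: "apply_seq S (normal_form2 M \<Delta>) [1..<Suc (length v)] (b # v) = Some u"
    "is_normal_form M \<Delta> (b # v) u"
    using Cons.IH ab(3) mem(2) nv by blast
  have value_u: "word_value M u = b \<otimes> word_value M v" and lists_u: "u \<in> lists S"
    and normal_u: "Delta_normal M \<Delta> u" and len_u: "length u = Suc (length v)"
    using u(2) by (simp_all add: is_normal_form_def words_def)
  have value_au: "a \<otimes> word_value M u = s \<otimes> (t \<otimes> word_value M v)"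
    using closed ab(4) by (simp add: value_u m_assoc [symmetric])
  \<comment> \<open>By \<open>nt\<close>, \<open>t\<close> absorbs every element of \<open>S\<close>
    dividing the value of \<open>t # v\<close>, so \<open>r\<close> already divides
    \<open>s \<otimes> t\<close>, and thus \<open>a\<close>.\<close>
  have "r divides a" if "r \<in> S" "r divides a \<otimes> word_value M u" for r
    using that divides_mult_head [OF Cons.prems(1) mem(1) that(1) _ nt] ab(5) closed
    by (simp add: value_au)
  then have "is_normal_form M \<Delta> (s # t # v) (a # u)"
    using ab lists_u normal_u len_u value_au
    by (simp add: is_normal_form_def words_def Delta_normal_Cons_iff)
  \<comment> \<open>After position 1, the pass is the one of the induction hypothesis, shifted
    behind the letter \<open>a\<close>.\<close>
  moreover have "[1..<Suc (length (t # v))] = 1 # map Suc [1..<Suc (length v)]"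
    by (subst upt_conv_Cons) (simp_all add: map_Suc_upt del: upt_Suc)
  moreover have "apply_at S (normal_form2 M \<Delta>) 1 (s # t # v) = Some (a # b # v)"
    using Cons.prems(1) mem ab by (simp add: apply_at_def)
  moreover have "apply_seq S (normal_form2 M \<Delta>) (map Suc [1..<Suc (length v)]) (a # b # v)
      = Some (a # u)"
    using u(1) by (subst apply_seq_map_Suc [OF ab(2)]) (auto simp del: upt_Suc)
  ultimately show ?case
    by (simp only: apply_seq.simps bind.bind_lunit) blast
qed

text \<open>The shifted part of \<open>delta\<close> normalizes the tail behind the first letter;
  the final ascending run is then the pass of \<open>normalize_Cons\<close>.\<close>

lemma apply_seq_delta_normalizes:
  assumes "w \<in> lists S"
  shows "\<exists>u. apply_seq S (normal_form2 M \<Delta>) (delta (length w)) w = Some u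
    \<and> is_normal_form M \<Delta> w u"
  using assms
proof (induction w)
  case Nil
  then show ?case by (simp add: is_normal_form_def words_def)
next
  case (Cons s w)
  then have s: "s \<in> S" by simp
  from Cons obtain v where v: "apply_seq S (normal_form2 M \<Delta>) (delta (length w)) w = Some v"
    "is_normal_form M \<Delta> w v" by auto
  then have v': "v \<in> lists S" "length v = length w" "Delta_normal M \<Delta> v"
    "word_value M v = word_value M w"
    by (simp_all add: is_normal_form_def words_def)
  obtain u where u: "apply_seq S (normal_form2 M \<Delta>) [1..<Suc (length w)] (s # v) = Some u"
    "is_normal_form M \<Delta> (s # v) u"
    using normalize_Cons [OF s v'(1,3)] v'(2) by auto
  have "apply_seq S (normal_form2 M \<Delta>) (delta (length (s # w))) (s # w) = Some u"
    using v(1) u(1) apply_seq_map_Suc [OF s, of "delta (length w)"] delta_pos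
    by (simp add: delta_Suc apply_seq_append del: upt_Suc delta.simps(3,4))
  moreover have "is_normal_form M \<Delta> (s # w) u"
    using u(2) v' by (simp add: is_normal_form_def)
  ultimately show ?case by blast
qed

end

theorem proposition2p13:
  fixes M :: "('a, 'b) monoid_scheme" and \<Delta> :: 'a and w :: "'a list" and p :: nat
  assumes "garside_monoid M \<Delta>"
    and "w \<in> words (Divs M \<Delta>) p"
  shows "(\<exists>!v. v \<in> words (Divs M \<Delta>) p \<and> Delta_normal M \<Delta> v \<and>
            word_value M v = word_value M w) \<and>
         (p \<ge> 2 \<longrightarrow>
            apply_seq (Divs M \<Delta>) (normal_form2 M \<Delta>) (delta p) w = Some (normal_form M \<Delta> w))"
proof -
  interpret garside_monoid M \<Delta> by fact
  have w: "w \<in> lists S" "length w = p"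
    using assms(2) by (simp_all add: words_def)
  \<comment> \<open>The computed word is also the existence witness, including for
    \<open>p < 2\<close>, where \<open>delta p\<close> is empty.\<close>
  obtain u where u: "apply_seq S (normal_form2 M \<Delta>) (delta p) w = Some u"
    "is_normal_form M \<Delta> w u"
    using apply_seq_delta_normalizes [OF w(1)] w(2) by blast
  have "\<exists>!v. is_normal_form M \<Delta> w v"
    using u(2) normal_form_eqI by metis
  moreover have "normal_form M \<Delta> w = u"
    using u(2) by (rule normal_form_eqI)
  ultimately show ?thesis
    using u(1) w(2) by (simp add: is_normal_form_def)
qed

end
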